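(* Let $S$ be a BC Stein AG-groupoid, let $L$ be a left ideal of $S$ and $R$ a right ideal of $S$, and let $x,y\in S$ satisfy $x=x^{2}$ and $y=y^{2}$. Then: (i) $xL=L\cap xS$; (ii) $Rx=Sx\cap R$; (iii) $Sy\cap xS=x(Sy)$.
   Context: A groupoid is a set with a binary operation, written as juxtaposition; $a^2=aa$. An AG-groupoid is a groupoid $S$ satisfying the left invertive law $(ab)c=(cb)a$ for all $a,b,c\in S$. A BC Stein AG-groupoid is an AG-groupoid $S$ satisfying $a(bc)=(bc)a$ for all $a,b,c\in S$. For subsets $A,B\subseteq S$, $AB=\{ab : a\in A,\ b\in B\}$; for $x\in S$ and $A\subseteq S$, $xA=\{xa : a\in A\}$ and $Ax=\{ax: a\in A\}$; $x(Sy)=\{x(sy): s\in S\}$. A subset $A\subseteq S$ is a left ideal of $S$ if $SA\subseteq A$ and a right ideal if $AS\subseteq A$. *)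

theory Defs
  imports Main
begin

text \<open>
  ``Groupoid'' means magma: a carrier closed under a binary operation. The operation is a
  function on the ambient type, and nothing is assumed about it outside the carrier.
\<close>

locale groupoid =
  fixes S :: "'a set" and mul :: "'a \<Rightarrow> 'a \<Rightarrow> 'a"
  assumes closed: "\<lbrakk>a \<in> S; b \<in> S\<rbrakk> \<Longrightarrow> mul a b \<in> S"

locale AG_groupoid = groupoid +
  assumes left_invertive:
    "\<lbrakk>a \<in> S; b \<in> S; c \<in> S\<rbrakk> \<Longrightarrow> mul (mul a b) c = mul (mul c b) a"

locale BC_Stein_AG_groupoid = AG_groupoid +
  assumes BC_Stein:
    "\<lbrakk>a \<in> S; b \<in> S; c \<in> S\<rbrakk> \<Longrightarrow> mul a (mul b c) = mul (mul b c) a"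

definition set_prod :: "('a \<Rightarrow> 'a \<Rightarrow> 'a) \<Rightarrow> 'a set \<Rightarrow> 'a set \<Rightarrow> 'a set" where
  "set_prod mul A B = {mul a b | a b. a \<in> A \<and> b \<in> B}"

definition left_translate :: "('a \<Rightarrow> 'a \<Rightarrow> 'a) \<Rightarrow> 'a \<Rightarrow> 'a set \<Rightarrow> 'a set" where
  "left_translate mul x A = {mul x a | a. a \<in> A}"

definition right_translate :: "('a \<Rightarrow> 'a \<Rightarrow> 'a) \<Rightarrow> 'a set \<Rightarrow> 'a \<Rightarrow> 'a set" where
  "right_translate mul A x = {mul a x | a. a \<in> A}"

definition left_ideal :: "'a set \<Rightarrow> ('a \<Rightarrow> 'a \<Rightarrow> 'a) \<Rightarrow> 'a set \<Rightarrow> bool" where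
  "left_ideal S mul A \<longleftrightarrow> A \<subseteq> S \<and> set_prod mul S A \<subseteq> A"

definition right_ideal :: "'a set \<Rightarrow> ('a \<Rightarrow> 'a \<Rightarrow> 'a) \<Rightarrow> 'a set \<Rightarrow> bool" where
  "right_ideal S mul A \<longleftrightarrow> A \<subseteq> S \<and> set_prod mul A S \<subseteq> A"

end

theory Submission
  imports Defs
begin

text \<open>
  By the Stein law with \<open>b = c = e\<close>, an idempotent \<open>e\<close> commutes with every element; the left
  invertive law then gives \<open>e a = (e e) a = (a e) e = e (e a)\<close>. Hence \<open>e\<close> fixes all of \<open>eS = Se\<close>
  under multiplication on either side, so an element of \<open>A \<inter> eS\<close> equals \<open>e\<close> times itself and lies
  in \<open>eA\<close>. For (iii), \<open>x (s y) = (y s) x = (x s) y\<close>.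
\<close>

context BC_Stein_AG_groupoid
begin

lemma idempotent_commute:
  assumes "e \<in> S" "e = mul e e" "a \<in> S"
  shows "mul a e = mul e a"
  using BC_Stein[OF assms(3,1,1)] by (simp flip: assms(2))

lemma idempotent_absorb_right:
  assumes "e \<in> S" "e = mul e e" "a \<in> S"
  shows "mul (mul a e) e = mul a e"
  using left_invertive[OF assms(1,1,3)] idempotent_commute[OF assms]
  by (simp flip: assms(2))

text \<open>Commuting \<open>e\<close> past \<open>a\<close>, then past \<open>mul e a\<close>,
  reduces this to absorption on the right.\<close>

lemma idempotent_absorb_left:
  assumes "e \<in> S" "e = mul e e" "a \<in> S"
  shows "mul e (mul e a) = mul e a"
  using idempotent_absorb_right[OF assms] idempotent_commute[OF assms]
    idempotent_commute[OF assms(1,2) closed[OF assms(1,3)]] by simp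

text \<open>This restricted associativity is what places \<open>mul e (mul s f)\<close> in Sf, with
  \<open>mul e s\<close> as the left factor.\<close>

lemma idempotent_mult_right:
  assumes "e \<in> S" "f \<in> S" "e = mul e e" "f = mul f f" "s \<in> S"
  shows "mul e (mul s f) = mul (mul e s) f"
proof -
  have "mul e (mul s f) = mul (mul f s) e"
    using idempotent_commute[OF assms(2,4,5)]
      idempotent_commute[OF assms(1,3) closed[OF assms(2,5)]] by simp
  also have "\<dots> = mul (mul e s) f"
    using assms(2,5,1) by (rule left_invertive)
  finally show ?thesis .
qed

lemma left_translate_left_ideal:
  assumes "left_ideal S mul L" "e \<in> S" "e = mul e e"
  shows "left_translate mul e L = L \<inter> left_translate mul e S"
proof
  show "left_translate mul e L \<subseteq> L \<inter> left_translate mul e S"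
    using assms(1,2) unfolding left_ideal_def set_prod_def left_translate_def by blast
  \<comment> \<open>An element \<open>mul e a\<close> of L is its own witness, being
    \<open>e\<close> times itself.\<close>
  show "L \<inter> left_translate mul e S \<subseteq> left_translate mul e L"
    using idempotent_absorb_left[OF assms(2,3)] unfolding left_translate_def by clarsimp metis
qed

lemma right_translate_right_ideal:
  assumes "right_ideal S mul R" "e \<in> S" "e = mul e e"
  shows "right_translate mul R e = right_translate mul S e \<inter> R"
proof
  show "right_translate mul R e \<subseteq> right_translate mul S e \<inter> R"
    using assms(1,2) unfolding right_ideal_def set_prod_def right_translate_def by blast
  show "right_translate mul S e \<inter> R \<subseteq> right_translate mul R e"
    using idempotent_absorb_right[OF assms(2,3)] unfolding right_translate_def by clarsimp metis
qed

lemma right_translate_Int_left_translate: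
  assumes "e \<in> S" "f \<in> S" "e = mul e e" "f = mul f f"
  shows "right_translate mul S f \<inter> left_translate mul e S
    = left_translate mul e (right_translate mul S f)"
proof
  \<comment> \<open>If \<open>mul s f = mul e a\<close>, then \<open>e\<close> fixes this element,
    so \<open>mul s f\<close> itself is the witness in Sf.\<close>
  show "right_translate mul S f \<inter> left_translate mul e S
    \<subseteq> left_translate mul e (right_translate mul S f)"
    using idempotent_absorb_left[OF assms(1,3)]
    unfolding left_translate_def right_translate_def by clarsimp metis
  \<comment> \<open>Membership in Sf comes from moving the bracket; membership in eS only needs
    \<open>mul s f\<close> to lie in S.\<close>
  show "left_translate mul e (right_translate mul S f)
    \<subseteq> right_translate mul S f \<inter> left_translate mul e S"
    using idempotent_mult_right[OF assms] closed assms(1,2)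
    unfolding left_translate_def right_translate_def by blast
qed

end

theorem theorem3:
  fixes S :: "'a set" and mul :: "'a \<Rightarrow> 'a \<Rightarrow> 'a"
    and L R :: "'a set" and x y :: 'a
  assumes "BC_Stein_AG_groupoid S mul"
    and "left_ideal S mul L"
    and "right_ideal S mul R"
    and "x \<in> S" and "y \<in> S"
    and "x = mul x x" and "y = mul y y"
  shows "left_translate mul x L = L \<inter> left_translate mul x S
    \<and> right_translate mul R x = right_translate mul S x \<inter> R
    \<and> right_translate mul S y \<inter> left_translate mul x S
        = left_translate mul x (right_translate mul S y)"
proof -
  interpret BC_Stein_AG_groupoid S mul by fact
  show ?thesis
    using left_translate_left_ideal[OF assms(2,4,6)] right_translate_right_ideal[OF assms(3,4,6)]
      right_translate_Int_left_translate[OF assms(4-7)] by (intro conjI)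
qed

end
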